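(* Let $n$ be odd and $F:\mathbb{F}_{2^n}\to\mathbb{F}_{2^n}$ a bijective almost bent function. The set $S=\{(x,F(x)):x\in\mathbb{F}_{2^n}\}$ is formally self dual under the trace pairing $\langle (x,y),(a,b)\rangle=(-1)^{\mathrm{Tr}(ax+by)}$ if and only if for all $a,b\in\mathbb{F}_{2^n}$: $\delta_F(a,b)=0 \iff W_F(a,b)=0$.
   Context: $\mathrm{Tr}:\mathbb{F}_{2^n}\to\mathbb{F}_2$ is the absolute trace $x\mapsto\sum_{i=0}^{n-1}x^{2^i}$. $\delta_F(a,b)=|\{x\in\mathbb{F}_{2^n}:F(x+a)+F(x)=b\}|$, $W_F(a,b)=\sum_{x\in\mathbb{F}_{2^n}}(-1)^{\mathrm{Tr}(bF(x)+ax)}$. $F$ is almost bent (AB) if $W_F(a,b)\in\{0,\pm 2^{(n+1)/2}\}$ for all $a\in\mathbb{F}_{2^n}$, $b\in\mathbb{F}_{2^n}^*$. A set $S\subset G=\mathbb{F}_{2^n}^2$ is formally self dual under the trace pairing if for all $(a,b)\in G$: $\big|\sum_{(x,y)\in S}(-1)^{\mathrm{Tr}(ax+by)}\big|^2=|S|\cdot|\{(s,t)\in S^2:s-t=(a,b)\}|$ (i.e. $S$ and $\Delta(S)$ form a formally dual pair for the isomorphism $\Delta:G\to\hat G$ determined by the pairing). *)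

theory Defs
  imports Complex_Main "HOL-Library.Cardinality" "HOL-Library.Product_Plus" "HOL-Number_Theory.Number_Theory"
begin

(* The field with 2^n elements is modelled by a type 'a of class finite_field with
   CARD('a) = 2 ^ n. The trace takes its values in the prime field {0, 1} of 'a; this is the
   lemma abs_trace_range below. *)

definition abs_trace :: "nat \<Rightarrow> 'a::finite_field \<Rightarrow> 'a" where
  "abs_trace n x = (\<Sum>i<n. x ^ (2 ^ i))"

(* (-1)^Tr(x), for Tr(x) in {0, 1} *)
definition trace_sign :: "nat \<Rightarrow> 'a::finite_field \<Rightarrow> int" where
  "trace_sign n x = (if abs_trace n x = 0 then 1 else - 1)"

definition diff_count :: "('a::finite_field \<Rightarrow> 'a) \<Rightarrow> 'a \<Rightarrow> 'a \<Rightarrow> nat" where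
  "diff_count F a b = card {x. F (x + a) + F x = b}"

definition walsh :: "nat \<Rightarrow> ('a::finite_field \<Rightarrow> 'a) \<Rightarrow> 'a \<Rightarrow> 'a \<Rightarrow> int" where
  "walsh n F a b = (\<Sum>x\<in>UNIV. trace_sign n (b * F x + a * x))"

(* Only meaningful for odd n, where (n + 1) div 2 is the exact half. *)
definition almost_bent :: "nat \<Rightarrow> ('a::finite_field \<Rightarrow> 'a) \<Rightarrow> bool" where
  "almost_bent n F \<longleftrightarrow>
     (\<forall>a b. b \<noteq> 0 \<longrightarrow> walsh n F a b \<in> {0, 2 ^ ((n + 1) div 2), - (2 ^ ((n + 1) div 2))})"

definition trace_pairing :: "nat \<Rightarrow> 'a::finite_field \<times> 'a \<Rightarrow> 'a \<times> 'a \<Rightarrow> complex" where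
  "trace_pairing n = (\<lambda>(x, y) (a, b). of_int (trace_sign n (a * x + b * y)))"

(* S and its image under g |-> pairing _ g form a formally dual pair; intended for pairings
   such that this map is an isomorphism from G onto its character group. *)
definition formally_self_dual ::
    "('g::{finite, ab_group_add} \<Rightarrow> 'g \<Rightarrow> complex) \<Rightarrow> 'g set \<Rightarrow> bool" where
  "formally_self_dual pairing S \<longleftrightarrow>
     (\<forall>g. (cmod (\<Sum>s\<in>S. pairing s g))\<^sup>2
        = real (card S) * real (card {(s, t). s \<in> S \<and> t \<in> S \<and> s - t = g}))"

lemma abs_trace_range:
  fixes x :: "'a::finite_field"
  assumes card: "CARD('a) = 2 ^ n"
  shows "abs_trace n x \<in> {0, 1}"
proof -
  have prime: "prime CHAR('a)"
    by (rule prime_CHAR_semidom[OF finite_imp_CHAR_pos[OF finite_class.finite_UNIV]])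
  moreover have "CHAR('a) dvd 2 ^ n"
    using CHAR_dvd_CARD[where 'a = 'a] unfolding card .
  ultimately have "CHAR('a) dvd 2"
    by (rule prime_dvd_power)
  then have char: "CHAR('a) = 2"
    by (rule primes_dvd_imp_eq[OF prime two_is_prime_nat])
  have "(abs_trace n x)\<^sup>2 = (\<Sum>i<n. (x ^ (2 ^ i)) ^ 2)"
    unfolding abs_trace_def by (rule freshmans_dream_sum[OF prime char[symmetric]])
  also have "\<dots> = (\<Sum>i<n. x ^ (2 ^ Suc i))"
    by (simp only: power_mult[symmetric] power_Suc2)
  also have "\<dots> = abs_trace n x + x ^ (2 ^ n) - x"
    using sum.lessThan_Suc_shift[of "\<lambda>i. x ^ (2 ^ i)" n]
    unfolding abs_trace_def sum.lessThan_Suc power_0 power_one_right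
    by (metis add_diff_cancel_left')
  also have "x ^ (2 ^ n) = x"
    using finite_field_power_card_eq_same[of x] card by simp
  finally show ?thesis
    by (simp add: power2_eq_square)
qed

end

theory Submission
  imports Defs
begin

text \<open>
  Formal self-duality says \<open>W(a,b)\<^sup>2 = 2\<^sup>n \<delta>(a,b)\<close> for all \<open>a, b\<close>, so it gives equal zero
  sets. Conversely, equal zero sets yield \<open>W(a,b)\<^sup>2 \<le> 2\<^sup>n \<delta>(a,b)\<close> pointwise: away from the
  origin a nonzero \<open>W(a,b)\<^sup>2\<close> is \<open>2\<^sup>n\<^sup>+\<^sup>1\<close>, while a nonzero \<open>\<delta>(a,b)\<close> is at least 2 because
  solutions come in pairs \<open>x\<close>, \<open>x + a\<close>. By Parseval both sides have the same total
  \<open>2\<^sup>3\<^sup>n\<close>, hence they agree everywhere.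
\<close>

lemma CHAR_eq_2_of_card_power_2:
  assumes card: "CARD('a::finite_field) = 2 ^ n"
  shows "CHAR('a) = 2"
proof -
  have prime: "prime CHAR('a)"
    by (rule prime_CHAR_semidom[OF finite_imp_CHAR_pos[OF finite_class.finite_UNIV]])
  moreover have "CHAR('a) dvd 2 ^ n"
    using CHAR_dvd_CARD[where 'a = 'a] unfolding card .
  ultimately have "CHAR('a) dvd 2"
    by (rule prime_dvd_power)
  then show ?thesis
    by (rule primes_dvd_imp_eq[OF prime two_is_prime_nat])
qed

lemma char_2_add_self:
  fixes x :: "'a::ring_1"
  assumes "CHAR('a) = 2"
  shows "x + x = 0"
proof -
  have "(2::'a) = of_nat CHAR('a)"
    unfolding assms by simp
  then have "(2::'a) = 0"
    by simp
  then show ?thesis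
    by (metis mult_2 mult_zero_left)
qed

lemma char_2_diff_eq_add:
  fixes x y :: "'a::ring_1"
  assumes "CHAR('a) = 2"
  shows "x - y = x + y"
  using char_2_add_self[OF assms, of y]
  by (simp add: diff_conv_add_uminus eq_neg_iff_add_eq_0 [symmetric])

text \<open>Each summand of the trace is an iterate of the Frobenius map, which is additive in
  characteristic 2.\<close>

lemma abs_trace_add:
  fixes x y :: "'a::finite_field"
  assumes "CHAR('a) = 2"
  shows "abs_trace n (x + y) = abs_trace n x + abs_trace n y"
proof -
  have "prime CHAR('a)"
    using assms by simp
  then have "(x + y) ^ (2 ^ i) = x ^ (2 ^ i) + y ^ (2 ^ i)" for i
    using freshmans_dream'[of "2 ^ i" i x y] assms by simp
  then show ?thesis
    by (simp add: abs_trace_def sum.distrib)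
qed

text \<open>Traces lie in \<open>{0, 1}\<close>, where \<open>1 + 1 = 0\<close>, so adding traces
  matches multiplying signs: \<open>trace_sign n\<close> is an additive character.\<close>

lemma trace_sign_add:
  fixes x y :: "'a::finite_field"
  assumes card: "CARD('a) = 2 ^ n"
  shows "trace_sign n (x + y) = trace_sign n x * trace_sign n y"
  using abs_trace_range[OF card, of x] abs_trace_range[OF card, of y]
    abs_trace_add[OF CHAR_eq_2_of_card_power_2[OF card], of n x y]
    char_2_add_self[OF CHAR_eq_2_of_card_power_2[OF card], of 1]
  by (auto simp: trace_sign_def)

lemma trace_sign_0 [simp]: "trace_sign n 0 = 1"
  by (simp add: trace_sign_def abs_trace_def power_0_left)

text \<open>The trace of 1 is a sum of \<open>n\<close> ones, so odd \<open>n\<close> provides an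
  explicit element with sign -1.\<close>

lemma trace_sign_1:
  assumes "CHAR('a::finite_field) = 2" and "odd n"
  shows "trace_sign n (1::'a) = - 1"
  using assms of_nat_eq_0_iff_char_dvd[where 'a = 'a, of n]
  by (simp add: trace_sign_def abs_trace_def)

text \<open>Orthogonality of characters. For \<open>z \<noteq> 0\<close>, shifting \<open>a\<close>
  by \<open>inverse z\<close> adds 1 to \<open>a * z\<close> and so flips every sign; the sum equals
  its own negative.\<close>

lemma sum_trace_sign_mult:
  fixes z :: "'a::finite_field"
  assumes card: "CARD('a) = 2 ^ n" and "odd n"
  shows "(\<Sum>a\<in>UNIV. trace_sign n (a * z)) = (if z = 0 then 2 ^ n else 0)"
proof (cases "z = 0")
  case True
  then show ?thesis
    by (simp add: card)
next
  case False
  have "(\<Sum>a\<in>UNIV. trace_sign n (a * z)) = (\<Sum>a\<in>UNIV. trace_sign n ((a + inverse z) * z))"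
    by (rule sum.reindex_bij_witness[of _ "\<lambda>a. a + inverse z" "\<lambda>a. a - inverse z"]) auto
  also have "\<dots> = - (\<Sum>a\<in>UNIV. trace_sign n (a * z))"
    using False trace_sign_1[OF CHAR_eq_2_of_card_power_2[OF card] \<open>odd n\<close>]
    by (simp add: distrib_right trace_sign_add[OF card] sum_negf)
  finally show ?thesis
    using False by simp
qed

text \<open>Expand the square into a double sum over \<open>x\<close> and \<open>y\<close> and sum
  over \<open>a\<close> first: orthogonality leaves only the diagonal, where
  \<open>F x + F x = 0\<close> makes each sign 1.\<close>

lemma parseval_walsh:
  fixes F :: "'a::finite_field \<Rightarrow> 'a"
  assumes card: "CARD('a) = 2 ^ n" and "odd n"
  shows "(\<Sum>a\<in>UNIV. (walsh n F a b)\<^sup>2) = 2 ^ n * 2 ^ n"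
proof -
  note char = CHAR_eq_2_of_card_power_2[OF card]
  have add_eq_0: "x + y = 0 \<longleftrightarrow> y = x" for x y :: 'a
    by (metis char_2_diff_eq_add[OF char] eq_iff_diff_eq_0)
  have "(\<Sum>a\<in>UNIV. (walsh n F a b)\<^sup>2) =
      (\<Sum>a\<in>UNIV. \<Sum>x\<in>UNIV. \<Sum>y\<in>UNIV.
         trace_sign n (b * (F x + F y)) * trace_sign n (a * (x + y)))"
    unfolding walsh_def power2_eq_square sum_product
    by (simp add: trace_sign_add[OF card] distrib_left mult_ac)
  also have "\<dots> = (\<Sum>x\<in>UNIV. \<Sum>y\<in>UNIV. \<Sum>a\<in>UNIV.
         trace_sign n (b * (F x + F y)) * trace_sign n (a * (x + y)))"
    by (subst sum.swap, rule sum.cong[OF refl], rule sum.swap)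
  also have "\<dots> = (\<Sum>x\<in>UNIV. \<Sum>y\<in>UNIV.
         trace_sign n (b * (F x + F y)) * (if y = x then 2 ^ n else 0))"
    by (simp only: sum_distrib_left[symmetric] sum_trace_sign_mult[OF card \<open>odd n\<close>] add_eq_0)
  also have "\<dots> = (\<Sum>x\<in>(UNIV :: 'a set). 2 ^ n)"
    by (simp add: if_distrib[of "\<lambda>c. _ * c"] char_2_add_self[OF char] cong: if_cong)
  finally show ?thesis
    by (simp add: card)
qed

text \<open>The solution sets for the various \<open>b\<close> are the fibres of one map on the
  field, hence a partition of it.\<close>

lemma sum_diff_count:
  fixes F :: "'a::finite_field \<Rightarrow> 'a"
  shows "(\<Sum>b\<in>UNIV. diff_count F a b) = CARD('a)"
  unfolding diff_count_def
  using sum.group[of UNIV UNIV "\<lambda>x. F (x + a) + F x" "\<lambda>_. 1::nat"] by simp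

lemma diff_count_0_0:
  fixes F :: "'a::finite_field \<Rightarrow> 'a"
  assumes "CHAR('a) = 2"
  shows "diff_count F 0 0 = CARD('a)"
  by (simp add: diff_count_def char_2_add_self[OF assms])

text \<open>Translation by \<open>a\<close> is an involution without fixed points, and it preserves
  the solution set because it only swaps the two summands.\<close>

lemma diff_count_ge_2:
  fixes F :: "'a::finite_field \<Rightarrow> 'a"
  assumes char: "CHAR('a) = 2" and "a \<noteq> 0" and "diff_count F a b \<noteq> 0"
  shows "diff_count F a b \<ge> 2"
proof -
  obtain x where x: "F (x + a) + F x = b"
    using assms(3) by (auto simp: diff_count_def card_eq_0_iff)
  have "x + a + a = x"
    using char_2_add_self[OF char, of a] by (simp add: add.assoc)
  then have "F (x + a + a) + F (x + a) = b"
    using x by (simp only: add.commute)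
  then have "{x, x + a} \<subseteq> {x. F (x + a) + F x = b}"
    using x by blast
  then have "card {x, x + a} \<le> diff_count F a b"
    unfolding diff_count_def by (intro card_mono) auto
  then show ?thesis
    using \<open>a \<noteq> 0\<close> by simp
qed

text \<open>A pair of graph points with first coordinates differing by \<open>a\<close> is
  determined by the first coordinate \<open>x\<close> of its second point.\<close>

lemma card_graph_differences:
  fixes F :: "'a::finite_field \<Rightarrow> 'a"
  assumes char: "CHAR('a) = 2"
  defines "S \<equiv> {(x, F x) | x. x \<in> UNIV}"
  shows "card {(s, t). s \<in> S \<and> t \<in> S \<and> s - t = (a, b)} = diff_count F a b"
proof -
  have "{(s, t). s \<in> S \<and> t \<in> S \<and> s - t = (a, b)} =
      (\<lambda>x. ((x + a, F (x + a)), (x, F x))) ` {x. F (x + a) - F x = b}"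
    by (auto simp: S_def image_iff)
  then show ?thesis
    unfolding diff_count_def char_2_diff_eq_add[OF char] by (simp add: card_image inj_on_def)
qed

lemma formally_self_dual_graph_iff:
  fixes F :: "'a::finite_field \<Rightarrow> 'a"
  assumes card: "CARD('a) = 2 ^ n"
  shows "formally_self_dual (trace_pairing n) {(x, F x) | x. x \<in> UNIV} \<longleftrightarrow>
    (\<forall>a b. (walsh n F a b)\<^sup>2 = 2 ^ n * int (diff_count F a b))"
proof -
  let ?S = "{(x, F x) | x. x \<in> UNIV}"
  have graph: "?S = (\<lambda>x. (x, F x)) ` UNIV"
    by auto
  have inj: "inj (\<lambda>x. (x, F x))"
    by (simp add: inj_def)
  have card_S: "card ?S = 2 ^ n"
    unfolding graph by (simp add: card_image[OF inj] card)
  have fourier: "(\<Sum>s\<in>?S. trace_pairing n s (a, b)) = of_int (walsh n F a b)" for a b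
    unfolding graph sum.reindex[OF inj] walsh_def
    by (simp add: trace_pairing_def add.commute)
  have "(cmod (\<Sum>s\<in>?S. trace_pairing n s (a, b)))\<^sup>2 =
       real (card ?S) * real (card {(s, t). s \<in> ?S \<and> t \<in> ?S \<and> s - t = (a, b)}) \<longleftrightarrow>
     (walsh n F a b)\<^sup>2 = 2 ^ n * int (diff_count F a b)" for a b
  proof -
    \<comment> \<open>Both sides are integers, so the real equation coming from \<open>cmod\<close>
      can be pulled back along the injective cast.\<close>
    have "(real_of_int (walsh n F a b))\<^sup>2 = 2 ^ n * real (diff_count F a b) \<longleftrightarrow>
        real_of_int ((walsh n F a b)\<^sup>2) = real_of_int (2 ^ n * int (diff_count F a b))"
      by simp
    then show ?thesis
      unfolding fourier card_S card_graph_differences[OF CHAR_eq_2_of_card_power_2[OF card]]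
      by (simp only: of_int_eq_iff norm_of_int power2_abs of_nat_power of_nat_numeral)
  qed
  then show ?thesis
    unfolding formally_self_dual_def split_paired_All by simp
qed

theorem theorem6p9:
  fixes n :: nat and F :: "'a::finite_field \<Rightarrow> 'a"
  assumes "CARD('a) = 2 ^ n" and "odd n"
    and "bij F" and "almost_bent n F"
  shows "formally_self_dual (trace_pairing n) {(x, F x) | x. x \<in> UNIV} \<longleftrightarrow>
         (\<forall>a b. diff_count F a b = 0 \<longleftrightarrow> walsh n F a b = 0)"
  unfolding formally_self_dual_graph_iff[OF assms(1)]
proof
  assume eq: "\<forall>a b. (walsh n F a b)\<^sup>2 = 2 ^ n * int (diff_count F a b)"
  show "\<forall>a b. diff_count F a b = 0 \<longleftrightarrow> walsh n F a b = 0"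
  proof (intro allI)
    fix a b
    show "diff_count F a b = 0 \<longleftrightarrow> walsh n F a b = 0"
      using eq[rule_format, of a b] by auto
  qed
next
  assume zeros: "\<forall>a b. diff_count F a b = 0 \<longleftrightarrow> walsh n F a b = 0"
  note char = CHAR_eq_2_of_card_power_2[OF assms(1)]
  have le: "(walsh n F a b)\<^sup>2 \<le> 2 ^ n * int (diff_count F a b)" for a b
  proof (cases "walsh n F a b = 0 \<or> (a = 0 \<and> b = 0)")
    case True
    \<comment> \<open>At the origin equality holds: the Walsh value and the solution count are both
      \<open>2 ^ n\<close>.\<close>
    then show ?thesis
      using assms(1) by (auto simp: walsh_def diff_count_0_0[OF char] power2_eq_square)
  next
    case False
    then have "diff_count F a b \<noteq> 0"
      using zeros by blast
    then obtain x where x: "F (x + a) + F x = b"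
      by (auto simp: diff_count_def card_eq_0_iff)
    \<comment> \<open>If \<open>a = 0\<close>, then \<open>b = F x + F x = 0\<close>, which is the
      excluded origin.\<close>
    have "a \<noteq> 0"
      using x False char_2_add_self[OF char, of "F x"] by auto
    \<comment> \<open>Injectivity of \<open>F\<close> yields \<open>b \<noteq> 0\<close>, the case
      covered by the almost bent condition.\<close>
    then have "F (x + a) \<noteq> F x"
      using bij_is_inj[OF assms(3)] by (simp add: inj_eq)
    then have "b \<noteq> 0"
      using x by (metis char_2_diff_eq_add[OF char] eq_iff_diff_eq_0)
    then have "walsh n F a b \<in> {2 ^ ((n + 1) div 2), - (2 ^ ((n + 1) div 2))}"
      using assms(4) False zeros \<open>diff_count F a b \<noteq> 0\<close>
      unfolding almost_bent_def by (metis insert_iff)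
    then have "(walsh n F a b)\<^sup>2 = (2 ^ ((n + 1) div 2))\<^sup>2"
      by auto
    also have "\<dots> = 2 ^ (n + 1)"
    proof -
      have "(n + 1) div 2 * 2 = n + 1"
        using assms(2) by presburger
      then show ?thesis
        by (simp only: power_mult[symmetric])
    qed
    also have "\<dots> \<le> 2 ^ n * int (diff_count F a b)"
      using diff_count_ge_2[OF char \<open>a \<noteq> 0\<close> \<open>diff_count F a b \<noteq> 0\<close>] by simp
    finally show ?thesis .
  qed
  \<comment> \<open>The order of summation differs on the two sides: Parseval sums over
    \<open>a\<close> for fixed \<open>b\<close>, the fibre count over \<open>b\<close> for fixed
    \<open>a\<close>.\<close>
  have "(\<Sum>(a, b)\<in>UNIV. (walsh n F a b)\<^sup>2) = (\<Sum>b\<in>UNIV. \<Sum>a\<in>UNIV. (walsh n F a b)\<^sup>2)"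
    by (subst sum.swap) (simp add: sum.cartesian_product)
  also have "\<dots> = 2 ^ n * (\<Sum>a\<in>(UNIV::'a set). int (\<Sum>b\<in>UNIV. diff_count F a b))"
    by (simp add: parseval_walsh[OF assms(1,2)] sum_diff_count assms(1) del: of_nat_sum)
  also have "\<dots> = (\<Sum>(a, b)\<in>UNIV. 2 ^ n * int (diff_count F a b))"
    by (simp add: sum_distrib_left sum.cartesian_product split_def)
  finally have total: "(\<Sum>(a, b)\<in>UNIV. (walsh n F a b)\<^sup>2) =
      (\<Sum>(a, b)\<in>UNIV. 2 ^ n * int (diff_count F a b))" .
  show "\<forall>a b. (walsh n F a b)\<^sup>2 = 2 ^ n * int (diff_count F a b)"
  proof (intro allI)
    fix a b
    show "(walsh n F a b)\<^sup>2 = 2 ^ n * int (diff_count F a b)"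
      using sum_mono_inv[OF total, of "(a, b)"] le by auto
  qed
qed

end
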